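(* Let $n\ge 2$ and $1\le k<n$ be integers, put $l=n+1-k$, and let $\mathbf{S}=\Delta P_0P_1\dots P_n$ be an $n$-dimensional simplex in $n$-dimensional Euclidean space. For every subset $V\subset\{0,\dots,n\}$ with $|V|=l$ let a point $Q_V$ be given in the interior of the face $\Delta\{P_v : v\in V\}$, and let $\mathfrak{R}$ be the resulting family of the $\binom{n+1}{k}$ $k$-cevians $\Delta(\{Q_V\}\cup\{P_u : u\in\{0,\dots,n\}\setminus V\})$, one for each such $V$. For each $l$-dimensional face $\mathbf{L}$ of $\mathbf{S}$ let $\mathfrak{r}_{\mathbf{L}}$ be the family of induced cevians in $\mathbf{L}$. Then the following conditions are equivalent: (1) There exists a point $X$ in the interior of $\mathbf{S}$ such that $X\in\bigcap\mathfrak{R}$. (2) For every $l$-dimensional face $\mathbf{L}$ of $\mathbf{S}$ one has $\bigcap\mathfrak{r}_{\mathbf{L}}\neq\emptyset$.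
   Context: $P_0,\dots,P_n$ are points in general position (affinely independent), and $\Delta$ applied to a list or set of points denotes the simplex spanned by them (their convex hull). The interior of a simplex is the set of convex combinations of its vertices with all coefficients strictly positive. An $m$-face of $\mathbf{S}$ is the simplex spanned by $m+1$ of the points $P_0,\dots,P_n$. A $k$-cevian of $\mathbf{S}$ is a simplex $\Delta Q_{U'}P_{u_1}\dots P_{u_k}$, where $U=\{u_1,\dots,u_k\}\subset\{0,\dots,n\}$ has $k$ elements, $U'=\{0,\dots,n\}\setminus U$ (so $|U'|=l=n+1-k$), and $Q_{U'}$, called its foot, is a point in the interior of the face spanned by $\{P_v : v\in U'\}$. Let $\mathbf{L}=\Delta\{P_j : j\in J\}$ be an $l$-face, $J\subset\{0,\dots,n\}$, $|J|=l+1$. For $t\in J$ the foot $Q_{J\setminus\{t\}}$ lies in the interior of the facet $\mathbf{L}_t$ of $\mathbf{L}$ opposite to $P_t$; the corresponding $k$-cevian is $C_t=\Delta(\{Q_{J\setminus\{t\}},P_t\}\cup\{P_i : i\notin J\})$, and the induced cevian in $\mathbf{L}$ is the segment $c_t=C_t\cap\mathbf{L}=\Delta Q_{J\setminus\{t\}}P_t$. The family of induced cevians is $\mathfrak{r}_{\mathbf{L}}=\{c_t : t\in J\}$ (it has $l+1$ members). *)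

theory Defs
  imports "HOL-Analysis.Analysis"
begin

text \<open>
  The vertices of a simplex are given by a map \<open>P\<close> from indices to points, and its faces are
  addressed by index sets \<open>J\<close>.  The feet are given by a map \<open>Q\<close> on index sets, \<open>Q V\<close> lying in the
  face with index set \<open>V\<close>; only its values on subsets of \<open>{0..n}\<close> of the right size matter.
\<close>

text \<open>For affinely independent \<open>A\<close> this is the interior relative to the affine hull of \<open>A\<close>, so it
  makes sense for proper faces too.\<close>

definition simplex_interior :: "'a::real_vector set \<Rightarrow> 'a set" where
  "simplex_interior A =
     {x. \<exists>c. (\<forall>v\<in>A. 0 < c v) \<and> sum c A = 1 \<and> x = (\<Sum>v\<in>A. c v *\<^sub>R v)}"

definition face :: "(nat \<Rightarrow> 'a::real_vector) \<Rightarrow> nat set \<Rightarrow> 'a set" where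
  "face P J = convex hull (P ` J)"

definition cevian ::
  "nat \<Rightarrow> (nat \<Rightarrow> 'a::real_vector) \<Rightarrow> (nat set \<Rightarrow> 'a) \<Rightarrow> nat set \<Rightarrow> 'a set" where
  "cevian n P Q V = convex hull ({Q V} \<union> P ` ({0..n} - V))"

definition cevian_family ::
  "nat \<Rightarrow> nat \<Rightarrow> (nat \<Rightarrow> 'a::real_vector) \<Rightarrow> (nat set \<Rightarrow> 'a) \<Rightarrow> 'a set set" where
  "cevian_family n k P Q = {cevian n P Q V | V. V \<subseteq> {0..n} \<and> card V = n + 1 - k}"

text \<open>The cevian induced in the face \<open>J\<close> at the vertex \<open>P t\<close>; its foot lies in the facet of that
  face opposite to \<open>P t\<close>.  See \<open>induced_cevian_eq\<close> for the description as a segment.\<close>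

definition induced_cevian ::
  "nat \<Rightarrow> (nat \<Rightarrow> 'a::real_vector) \<Rightarrow> (nat set \<Rightarrow> 'a) \<Rightarrow> nat set \<Rightarrow> nat \<Rightarrow> 'a set" where
  "induced_cevian n P Q J t = cevian n P Q (J - {t}) \<inter> face P J"

lemma induced_cevian_eq:
  fixes P :: "nat \<Rightarrow> 'a::euclidean_space"
  assumes inj: "inj_on P {0..n}" and indep: "\<not> affine_dependent (P ` {0..n})"
    and J: "J \<subseteq> {0..n}" and t: "t \<in> J"
    and Q: "Q (J - {t}) \<in> simplex_interior (P ` (J - {t}))"
  shows "induced_cevian n P Q J t = convex hull {Q (J - {t}), P t}"
proof -
  define q where "q = Q (J - {t})"
  define B where "B = P ` ({0..n} - J)"
  let ?A = "{q, P t}" and ?L = "convex hull (P ` J)"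
  have finJ: "finite J"
    using J finite_subset by blast
  obtain c where "\<forall>v\<in>P ` (J - {t}). 0 < c v" "sum c (P ` (J - {t})) = 1"
      "q = (\<Sum>v\<in>P ` (J - {t}). c v *\<^sub>R v)"
    using Q unfolding simplex_interior_def q_def by blast
  then have "q \<in> convex hull (P ` (J - {t}))"
    unfolding convex_hull_finite[OF finite_imageI[OF finite_Diff[OF finJ]]]
    by (intro CollectI exI[of _ c]) (simp add: less_imp_le)
  then have "q \<in> ?L"
    by (meson Diff_subset hull_mono image_mono subsetD)
  moreover have "P t \<in> ?L"
    using t by (simp add: hull_inc)
  ultimately have AL: "convex hull ?A \<subseteq> ?L"
    by (simp add: hull_minimal)
  have cev: "cevian n P Q (J - {t}) = convex hull (?A \<union> B)"
  proof -
    have "{0..n} - (J - {t}) = insert t ({0..n} - J)"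
      using J t by auto
    then show ?thesis
      by (simp add: cevian_def q_def B_def insert_commute)
  qed
  have "affine hull (P ` J) \<inter> affine hull B = {}"
  proof (rule disjoint_affine_hull[OF indep])
    show "P ` J \<inter> B = {}"
      using inj J unfolding B_def inj_on_def by blast
  qed (use J B_def in auto)
  moreover have "?L \<subseteq> affine hull (P ` J)" "convex hull B \<subseteq> affine hull B"
    by (simp_all add: convex_hull_subset_affine_hull)
  ultimately have disj: "w \<notin> affine hull (P ` J)" if "w \<in> convex hull B" for w
    using that by blast
  have "x \<in> convex hull ?A" if x: "x \<in> convex hull (?A \<union> B)" "x \<in> ?L" for x
  proof (cases "B = {}")
    case True
    then show ?thesis using x by simp
  next
    case False
    then obtain a b u w where uw: "0 \<le> a" "0 \<le> b" "a + b = 1" "u \<in> convex hull ?A"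
        "w \<in> convex hull B" "x = a *\<^sub>R u + b *\<^sub>R w"
    proof -
      have "?A \<union> B \<subseteq> convex hull ?A \<union> convex hull B"
        using hull_subset[of ?A convex] hull_subset[of B convex] by blast
      then have "x \<in> convex hull (convex hull ?A \<union> convex hull B)"
        using x(1) hull_mono by blast
      moreover have "convex hull ?A \<noteq> {}" "convex hull B \<noteq> {}"
        using False by simp_all
      ultimately show ?thesis
        using that unfolding convex_hull_union_two[OF convex_convex_hull
            \<open>convex hull ?A \<noteq> {}\<close> convex_convex_hull \<open>convex hull B \<noteq> {}\<close>] by blast
    qed
    show ?thesis
    proof (cases "b = 0")
      case True
      then show ?thesis using uw by simp
    next
      case False
      have "w = (1 / b) *\<^sub>R x + (- a / b) *\<^sub>R u"
        using uw(6) False by (simp add: scaleR_right_distrib)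
      moreover have "1 / b + - a / b = 1"
        using uw(3) False by (simp add: field_simps)
      moreover have "x \<in> affine hull (P ` J)" "u \<in> affine hull (P ` J)"
        using x(2) uw(4) AL \<open>?L \<subseteq> affine hull (P ` J)\<close> by blast+
      ultimately have "w \<in> affine hull (P ` J)"
        using mem_affine[OF affine_affine_hull] by metis
      then show ?thesis using disj uw(5) by blast
    qed
  qed
  moreover have "convex hull ?A \<subseteq> convex hull (?A \<union> B)"
    by (simp add: hull_mono)
  ultimately show ?thesis
    using AL unfolding induced_cevian_def face_def cev q_def[symmetric] by blast
qed

definition induced_family ::
  "nat \<Rightarrow> (nat \<Rightarrow> 'a::real_vector) \<Rightarrow> (nat set \<Rightarrow> 'a) \<Rightarrow> nat set \<Rightarrow> 'a set set" where
  "induced_family n P Q J = {induced_cevian n P Q J t | t. t \<in> J}"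

end

theory Submission
  imports Defs
begin

text \<open>
  The equivalence is a statement about barycentric coordinates.  Write \<open>X = (\<Sum>i. x i *\<^sub>R P i)\<close>
  with nonnegative \<open>x\<close>, and let \<open>w V\<close> be the positive coordinates of the foot \<open>Q V\<close> on \<open>V\<close>.
  Moving from \<open>Q V\<close> towards the vertices outside \<open>V\<close> rescales the coordinates on \<open>V\<close> by a common
  factor and leaves the others arbitrary, so \<open>X\<close> lies on the cevian with foot \<open>Q V\<close> if and only if
  \<open>x\<close> and \<open>w V\<close> are proportional on \<open>V\<close> (\<open>mem_cevian_iff_proportional\<close>).  The same criterion,
  read in the simplex spanned by a face, describes the induced cevians.

  If \<open>x\<close> is positive and proportional to every \<open>w V\<close>, then its restriction to the index set \<open>J\<close> of
  an \<open>l\<close>-face, rescaled to have sum 1, is a common point of the cevians induced in that face.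

  Conversely, let a common point with coordinates \<open>y J\<close> be given in every \<open>l\<close>-face.  Since
  \<open>l \<ge> 2\<close>, proportionality to the positive \<open>w (J - {t})\<close> for all \<open>t\<close> forces \<open>y J\<close> to be positive
  (\<open>pos_if_proportional_on_facets\<close>).  It also makes \<open>w V\<close> and \<open>w V'\<close> proportional on \<open>V \<inter> V'\<close>
  whenever \<open>V\<close> and \<open>V'\<close> are facets of one \<open>l\<close>-face.  Any two \<open>l\<close>-sets containing \<open>i\<close> and \<open>j\<close> are
  connected by exchanging one element at a time while keeping \<open>i\<close> and \<open>j\<close>, so the ratio of the
  coordinates at \<open>i\<close> and \<open>j\<close> does not depend on the \<open>l\<close>-set that is used to read it off
  (\<open>ratio_independent\<close>).  An \<open>l\<close>-face through three given vertices shows that these ratios are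
  multiplicative, hence they are the ratios of a single positive family \<open>x\<close>
  (\<open>common_coordinates_exist\<close>), and this family, normalised, is the required interior point.
\<close>

section \<open>Families that agree up to a factor\<close>

text \<open>Cross-multiplication makes this symmetric and defined for vanishing families as well; if
  \<open>w\<close> does not vanish on all of \<open>V\<close>, it says that \<open>x\<close> is a multiple of \<open>w\<close> on \<open>V\<close>.\<close>

definition proportional_on :: "'i set \<Rightarrow> ('i \<Rightarrow> real) \<Rightarrow> ('i \<Rightarrow> real) \<Rightarrow> bool" where
  "proportional_on V x w \<longleftrightarrow> (\<forall>i\<in>V. \<forall>j\<in>V. x i * w j = x j * w i)"

lemma proportional_onD:
  "proportional_on V x w \<Longrightarrow> i \<in> V \<Longrightarrow> j \<in> V \<Longrightarrow> x i * w j = x j * w i"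
  by (simp add: proportional_on_def)

lemma proportional_on_scale:
  "proportional_on V x w \<Longrightarrow> proportional_on V (\<lambda>i. x i / s) w"
  by (simp add: proportional_on_def)

text \<open>The factor is the total weight, because \<open>w\<close> is normalised.\<close>

lemma proportional_on_eq_multiple:
  assumes "proportional_on V x w" and "sum w V = 1" and "i \<in> V"
  shows "x i = sum x V * w i"
proof -
  have "x i = (\<Sum>j\<in>V. x i * w j)"
    using assms(2) by (simp flip: sum_distrib_left)
  also have "\<dots> = (\<Sum>j\<in>V. x j * w i)"
    using assms(1,3) by (intro sum.cong) (auto simp: proportional_on_def)
  finally show ?thesis
    by (simp add: sum_distrib_right)
qed

text \<open>Some \<open>y s\<close> is positive, and any other index \<open>i\<close> can be compared with \<open>s\<close> on a facet that
  contains both; this is where at least three indices are needed.\<close>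

lemma pos_if_proportional_on_facets:
  assumes "finite J" and "3 \<le> card J"
    and nonneg: "\<And>i. i \<in> J \<Longrightarrow> 0 \<le> y i" and total: "sum y J = (1::real)"
    and w: "\<And>t i. t \<in> J \<Longrightarrow> i \<in> J - {t} \<Longrightarrow> 0 < w (J - {t}) i"
    and prop_w: "\<And>t. t \<in> J \<Longrightarrow> proportional_on (J - {t}) y (w (J - {t}))"
    and "i \<in> J"
  shows "0 < y i"
proof -
  obtain s where s: "s \<in> J" "0 < y s"
    using total nonneg by (metis less_eq_real_def sum.neutral zero_neq_one)
  show ?thesis
  proof (cases "i = s")
    case False
    have "card {i, s} < card J"
      using assms(2) False by simp
    then obtain t where t: "t \<in> J" "t \<noteq> i" "t \<noteq> s"
      by (metis assms(1) card_mono finite.emptyI finite.insertI insertCI leD subsetI)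
    then have "y i * w (J - {t}) s = y s * w (J - {t}) i"
      using prop_w[OF t(1)] s \<open>i \<in> J\<close> by (auto intro: proportional_onD)
    moreover have "0 < w (J - {t}) s" "0 < w (J - {t}) i"
      using w[OF t(1)] t s \<open>i \<in> J\<close> by auto
    ultimately show ?thesis
      using s by (metis zero_less_mult_pos2 mult_pos_pos)
  qed (use s in simp)
qed

section \<open>Gluing local coordinates\<close>

text \<open>The induction exchanges an element of \<open>V - W\<close> for one of \<open>W - V\<close>.  The two sets before and
  after the exchange are facets of their union, and there \<open>y\<close> mediates between their weights.\<close>

lemma ratio_independent:
  assumes "finite I" and "V \<subseteq> I" "card V = l" and "W \<subseteq> I" "card W = l"
    and y: "\<And>J. J \<subseteq> I \<Longrightarrow> card J = Suc l \<Longrightarrow>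
      \<exists>y. (\<forall>i\<in>J. 0 < y i) \<and> (\<forall>t\<in>J. proportional_on (J - {t}) y (w (J - {t})))"
    and w: "\<And>V i. V \<subseteq> I \<Longrightarrow> card V = l \<Longrightarrow> i \<in> V \<Longrightarrow> (0::real) < w V i"
    and "i \<in> V" "i \<in> W" "j \<in> V" "j \<in> W"
  shows "w V i * w W j = w V j * w W i"
  using assms(2,3,8,10)
proof (induction "card (V - W)" arbitrary: V)
  case 0
  then have "V \<subseteq> W"
    using \<open>finite I\<close> by (simp add: finite_subset)
  then have "V = W"
    using 0 assms by (metis card_subset_eq finite_subset)
  then show ?case by simp
next
  case (Suc m)
  have fin: "finite V" "finite W"
    using Suc assms finite_subset by metis+
  obtain a where a: "a \<in> V" "a \<notin> W"
    using Suc(2) by (metis card.empty Diff_iff ex_in_conv nat.distinct(1))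
  have "\<not> W \<subseteq> V"
    using a fin Suc.prems assms(5) by (metis card_subset_eq)
  then obtain b where b: "b \<in> W" "b \<notin> V" by blast
  define V' where "V' = insert b (V - {a})"
  define J where "J = insert b V"
  have J: "J \<subseteq> I" "card J = Suc l" "J - {b} = V" "J - {a} = V'"
    using a b fin Suc.prems assms(4) by (auto simp: J_def V'_def)
  have "card V' = l"
    using J(2,4) fin a by (metis J_def card_Diff_singleton diff_Suc_1 insertCI)
  then have V': "V' \<subseteq> I" "card V' = l" "i \<in> V'" "j \<in> V'"
    using J(1,4) a Suc.prems(3,4) assms(9,11) by (auto simp: V'_def)
  have "V' - W = (V - W) - {a}"
    using b by (auto simp: V'_def)
  then have "m = card (V' - W)"
    using Suc(2) a by simp
  then have IH: "w V' i * w W j = w V' j * w W i"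
    using Suc(1) V' by blast
  obtain y where y: "\<forall>i\<in>J. 0 < y i" "\<forall>t\<in>J. proportional_on (J - {t}) y (w (J - {t}))"
    using y J by blast
  have pos: "0 < y i" "0 < y j"
    using y Suc.prems J by auto
  have "y i * w V j = y j * w V i"
    using y(2) J(3) Suc.prems by (metis J_def insertI1 proportional_onD)
  moreover have "y i * w V' j = y j * w V' i"
    using y(2) J(4) V' a by (metis J_def insertCI proportional_onD)
  ultimately have r: "w V i = y i / y j * w V j" "w V' i = y i / y j * w V' j"
    using pos by (simp_all add: field_simps)
  have "w V' j * (y i / y j * w W j) = w V' j * w W i"
    using IH r(2) by (simp add: algebra_simps)
  moreover have "w V' j \<noteq> 0"
    using w[OF V'(1,2,4)] by simp
  ultimately have W: "w W i = y i / y j * w W j"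
    by (metis mult_left_cancel)
  show ?case
    unfolding r(1) W by (simp only: mult_ac)
qed

text \<open>Fix an index \<open>e\<close> and put \<open>x i = w V i / w V e\<close> for some \<open>V\<close> containing \<open>i\<close> and \<open>e\<close>.
  Proportionality on \<open>V\<close> only concerns two indices \<open>i\<close> and \<open>j\<close> at a time; an \<open>l\<close>-face through
  \<open>i\<close>, \<open>j\<close> and \<open>e\<close> relates their three ratios, even if \<open>l = 2\<close> and no foot sees all three.\<close>

lemma common_coordinates_exist:
  assumes "finite I" and "2 \<le> l" and "l < card I"
    and w: "\<And>V i. V \<subseteq> I \<Longrightarrow> card V = l \<Longrightarrow> i \<in> V \<Longrightarrow> (0::real) < w V i"
    and y: "\<And>J. J \<subseteq> I \<Longrightarrow> card J = Suc l \<Longrightarrow>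
      \<exists>y. (\<forall>i\<in>J. 0 < y i) \<and> (\<forall>t\<in>J. proportional_on (J - {t}) y (w (J - {t})))"
  shows "\<exists>x. (\<forall>i\<in>I. 0 < x i) \<and> (\<forall>V. V \<subseteq> I \<longrightarrow> card V = l \<longrightarrow> proportional_on V x (w V))"
proof -
  have "I \<noteq> {}"
    using assms(3) by auto
  then obtain e where e: "e \<in> I"
    by blast
  have "\<exists>V. V \<subseteq> I \<and> card V = l \<and> i \<in> V \<and> e \<in> V" if "i \<in> I" for i
  proof -
    have "card {i, e} \<le> l"
      using assms(2) by (simp add: card_insert_if)
    moreover have "{i, e} \<subseteq> I" "l \<le> card I"
      using that e assms(3) by auto
    ultimately obtain V where "{i, e} \<subseteq> V" "V \<subseteq> I" "card V = l"
      using exists_subset_between assms(1) by metis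
    then show ?thesis by auto
  qed
  then obtain F where F: "\<And>i. i \<in> I \<Longrightarrow> F i \<subseteq> I \<and> card (F i) = l \<and> i \<in> F i \<and> e \<in> F i"
    by metis
  define x where "x i = w (F i) i / w (F i) e" for i
  have x_pos: "0 < x i" if "i \<in> I" for i
    using F[OF that] w by (simp add: x_def)
  have x_eq: "w V i = x i * w V e" if V: "V \<subseteq> I" "card V = l" "i \<in> V" "e \<in> V" for V i
  proof -
    have i: "i \<in> I" using V by blast
    then have "w V i * w (F i) e = w V e * w (F i) i"
      using V F[OF i] by (intro ratio_independent[OF \<open>finite I\<close> _ _ _ _ y w]) auto
    moreover have "0 < w (F i) e"
      using F[OF i] w by blast
    ultimately show ?thesis
      by (simp add: x_def field_simps)
  qed
  have "x i * w V j = x j * w V i" if V: "V \<subseteq> I" "card V = l" "i \<in> V" "j \<in> V" for V i j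
  proof (cases "i = j \<or> e \<in> V")
    case True
    then show ?thesis
    proof
      assume e_in: "e \<in> V"
      have "x i * w V j = x i * (x j * w V e)"
        by (subst x_eq[OF V(1,2,4) e_in]) (rule refl)
      also have "\<dots> = x j * (x i * w V e)"
        by simp
      also have "\<dots> = x j * w V i"
        by (subst x_eq[OF V(1,2,3) e_in]) (rule refl)
      finally show ?thesis .
    qed simp
  next
    case False
    define J where "J = insert e V"
    have "finite V" using V \<open>finite I\<close> finite_subset by blast
    then have J: "J \<subseteq> I" "card J = Suc l" "J - {e} = V"
      using False V e by (auto simp: J_def)
    obtain y where y_pos: "\<forall>i\<in>J. 0 < y i"
      and y_prop: "\<forall>t\<in>J. proportional_on (J - {t}) y (w (J - {t}))"
      using y[OF J(1,2)] by blast
    \<comment> \<open>The facet opposite to \<open>t\<close> contains both \<open>p\<close> and \<open>e\<close>, so there \<open>y\<close> can be compared with \<open>x\<close>.\<close>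
    have y_eq: "y p = x p * y e" if p: "p \<in> V" "t \<in> V" "t \<noteq> p" for p t
    proof -
      let ?V = "J - {t}"
      have V': "?V \<subseteq> I" "card ?V = l" "p \<in> ?V" "e \<in> ?V" "t \<in> J"
        using J p False \<open>finite V\<close> by (auto simp: J_def)
      then have "y p * w ?V e = y e * w ?V p"
        using y_prop by (auto intro: proportional_onD)
      moreover have "w ?V p = x p * w ?V e"
        using V' x_eq by blast
      moreover have "0 < w ?V e"
        using w V' by blast
      ultimately show ?thesis by simp
    qed
    have "y i = x i * y e" "y j = x j * y e"
      using y_eq V False by blast+
    moreover have "y i * w V j = y j * w V i"
      using y_prop J(3) V by (metis J_def insertI1 proportional_onD)
    moreover have "0 < y e"
      using y_pos by (simp add: J_def)
    ultimately show ?thesis by simp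
  qed
  then show ?thesis
    using x_pos by (intro exI[of _ x]) (simp add: proportional_on_def)
qed

section \<open>Barycentric coordinates\<close>

lemma simplex_interior_image:
  assumes "inj_on P I"
  shows "X \<in> simplex_interior (P ` I) \<longleftrightarrow>
    (\<exists>x. (\<forall>i\<in>I. 0 < x i) \<and> sum x I = 1 \<and> X = (\<Sum>i\<in>I. x i *\<^sub>R P i))"
proof
  assume "X \<in> simplex_interior (P ` I)"
  then obtain c where "\<forall>v\<in>P ` I. 0 < c v" "sum c (P ` I) = 1" "X = (\<Sum>v\<in>P ` I. c v *\<^sub>R v)"
    unfolding simplex_interior_def by blast
  then show "\<exists>x. (\<forall>i\<in>I. 0 < x i) \<and> sum x I = 1 \<and> X = (\<Sum>i\<in>I. x i *\<^sub>R P i)"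
    using assms by (intro exI[of _ "c \<circ> P"]) (simp add: sum.reindex)
next
  assume "\<exists>x. (\<forall>i\<in>I. 0 < x i) \<and> sum x I = 1 \<and> X = (\<Sum>i\<in>I. x i *\<^sub>R P i)"
  then obtain x where "\<forall>i\<in>I. 0 < x i" "sum x I = 1" "X = (\<Sum>i\<in>I. x i *\<^sub>R P i)"
    by blast
  then show "X \<in> simplex_interior (P ` I)"
    using assms unfolding simplex_interior_def
    by (intro CollectI exI[of _ "x \<circ> the_inv_into I P"]) (simp add: sum.reindex the_inv_into_f_f)
qed

lemma convex_hull_image_coordinates:
  assumes "finite I" and "inj_on P I" and "X \<in> convex hull (P ` I)"
  obtains x where "\<And>i. i \<in> I \<Longrightarrow> 0 \<le> x i" "sum x I = 1" "X = (\<Sum>i\<in>I. x i *\<^sub>R P i)"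
proof -
  obtain c where "\<forall>v\<in>P ` I. 0 \<le> c v" "sum c (P ` I) = 1" "(\<Sum>v\<in>P ` I. c v *\<^sub>R v) = X"
    using assms(3) unfolding convex_hull_finite[OF finite_imageI[OF assms(1)]] by blast
  then show ?thesis
    using assms(2) by (intro that[of "c \<circ> P"]) (auto simp: sum.reindex)
qed

lemma barycentric_unique:
  assumes "finite I" and "inj_on P I" and "\<not> affine_dependent (P ` I)"
    and "sum x I = sum z I" and "(\<Sum>i\<in>I. x i *\<^sub>R P i) = (\<Sum>i\<in>I. z i *\<^sub>R P i)" and "i \<in> I"
  shows "x i = z i"
proof (rule ccontr)
  assume "x i \<noteq> z i"
  define c where "c v = x (the_inv_into I P v) - z (the_inv_into I P v)" for v
  have c: "c (P i) = x i - z i" if "i \<in> I" for i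
    using assms(2) that by (simp add: c_def the_inv_into_f_f)
  have "sum c (P ` I) = 0" "(\<Sum>v\<in>P ` I. c v *\<^sub>R v) = 0"
    using assms(2,4,5)
    by (simp_all add: sum.reindex c sum_subtractf scaleR_left_diff_distrib cong: sum.cong)
  moreover have "\<exists>v\<in>P ` I. c v \<noteq> 0"
    using c \<open>i \<in> I\<close> \<open>x i \<noteq> z i\<close> by auto
  ultimately show False
    using assms(3) affine_dependent_explicit_finite[OF finite_imageI[OF assms(1)]] by blast
qed

text \<open>The points whose coordinates are proportional to \<open>w\<close> on \<open>V\<close> form a convex set that contains
  \<open>q\<close> and the vertices outside \<open>V\<close>, hence the whole cevian, and coordinates are unique.
  Conversely, such a point is the combination of \<open>q\<close> and these vertices in which \<open>q\<close> has the total
  weight of \<open>x\<close> on \<open>V\<close>.\<close>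

lemma mem_cevian_iff_proportional:
  assumes "finite I" and "inj_on P I" and indep: "\<not> affine_dependent (P ` I)"
    and "V \<subseteq> I" and w: "sum w V = 1" and q: "q = (\<Sum>i\<in>V. w i *\<^sub>R P i)"
    and x: "\<And>i. i \<in> I \<Longrightarrow> 0 \<le> x i" "sum x I = 1" and X: "X = (\<Sum>i\<in>I. x i *\<^sub>R P i)"
  shows "X \<in> convex hull ({q} \<union> P ` (I - V)) \<longleftrightarrow> proportional_on V x w"
proof
  define S where "S = {(\<Sum>i\<in>I. z i *\<^sub>R P i) | z. sum z I = 1 \<and> proportional_on V z w}"
  have S_I: "a \<in> S"
    if "(\<Sum>i\<in>I. z i *\<^sub>R P i) = a" "sum z I = 1" "proportional_on V z w" for z a
    using that unfolding S_def by blast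
  have "convex S"
  proof (rule convexI)
    fix a b and u v :: real
    assume "a \<in> S" "b \<in> S" and uv: "0 \<le> u" "0 \<le> v" "u + v = 1"
    then obtain f g where f: "a = (\<Sum>i\<in>I. f i *\<^sub>R P i)" "sum f I = 1" "proportional_on V f w"
      and g: "b = (\<Sum>i\<in>I. g i *\<^sub>R P i)" "sum g I = 1" "proportional_on V g w"
      unfolding S_def by blast
    let ?h = "\<lambda>i. u * f i + v * g i"
    have "u *\<^sub>R a + v *\<^sub>R b = (\<Sum>i\<in>I. ?h i *\<^sub>R P i)"
      by (simp add: f(1) g(1) scaleR_left_distrib sum.distrib scaleR_sum_right)
    moreover have "sum ?h I = 1"
      using f(2) g(2) uv by (simp add: sum.distrib flip: sum_distrib_left)
    moreover have "proportional_on V ?h w"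
      using f(3) g(3) unfolding proportional_on_def
      by (simp add: distrib_right mult.assoc)
    ultimately show "u *\<^sub>R a + v *\<^sub>R b \<in> S"
      by (metis S_I)
  qed
  moreover have "q \<in> S"
  proof -
    let ?z = "\<lambda>i. if i \<in> V then w i else 0"
    have "(\<Sum>i\<in>I. ?z i *\<^sub>R P i) = q" "sum ?z I = 1"
      using assms(1,4) w q
      by (auto simp: if_distrib[of "\<lambda>c. c *\<^sub>R _"] sum.If_cases Int_absorb1 cong: if_cong)
    moreover have "proportional_on V ?z w"
      by (simp add: proportional_on_def)
    ultimately show ?thesis
      by (intro S_I[of ?z])
  qed
  moreover have "P j \<in> S" if "j \<in> I - V" for j
  proof -
    let ?z = "\<lambda>i. if i = j then 1 else 0 :: real"
    have "(\<Sum>i\<in>I. ?z i *\<^sub>R P i) = P j" "sum ?z I = 1"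
      using assms(1) that by (simp_all add: if_distrib[of "\<lambda>c. c *\<^sub>R _"] cong: if_cong)
    moreover have "proportional_on V ?z w"
      using that by (auto simp: proportional_on_def)
    ultimately show ?thesis
      by (intro S_I[of ?z])
  qed
  ultimately have hull: "convex hull ({q} \<union> P ` (I - V)) \<subseteq> S"
    by (intro hull_minimal) auto
  assume "X \<in> convex hull ({q} \<union> P ` (I - V))"
  then obtain z where z: "X = (\<Sum>i\<in>I. z i *\<^sub>R P i)" "sum z I = 1" "proportional_on V z w"
    using hull unfolding S_def by blast
  have "x i = z i" if "i \<in> I" for i
    by (rule barycentric_unique[OF assms(1-3) _ _ that]) (simp_all add: x(2) z(2) flip: X z(1))
  then show "proportional_on V x w"
    using z(3) \<open>V \<subseteq> I\<close> by (auto simp: proportional_on_def subset_iff)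
next
  assume prop_w: "proportional_on V x w"
  have fin: "finite V" "finite (I - V)"
    using assms(1,4) finite_subset by auto
  obtain v where v: "v \<in> V"
    using w by (metis all_not_in_conv sum.empty zero_neq_one)
  \<comment> \<open>No index of \<open>I - V\<close> belongs to \<open>q\<close>, so \<open>v \<in> V\<close> is reused to label this vertex of the cevian.\<close>
  let ?K = "insert v (I - V)"
  let ?a = "\<lambda>i. if i = v then sum x V else x i"
  let ?p = "\<lambda>i. if i = v then q else P i"
  have rest: "sum ?a (I - V) = sum x (I - V)"
      "(\<Sum>i\<in>I - V. ?a i *\<^sub>R ?p i) = (\<Sum>i\<in>I - V. x i *\<^sub>R P i)"
    using v by (auto intro!: sum.cong)
  have "sum x I = sum x V + sum x (I - V)"
    using sum.subset_diff[OF assms(4,1), of x] by simp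
  then have total: "sum ?a ?K = 1"
    using v fin rest(1) x(2) by simp
  have "(\<Sum>i\<in>V. x i *\<^sub>R P i) = sum x V *\<^sub>R q"
    unfolding q scaleR_sum_right
    by (intro sum.cong) (simp_all add: proportional_on_eq_multiple[OF prop_w w])
  then have "X = sum x V *\<^sub>R q + (\<Sum>i\<in>I - V. x i *\<^sub>R P i)"
    using sum.subset_diff[OF assms(4,1), of "\<lambda>i. x i *\<^sub>R P i"] by (simp add: X add.commute)
  then have "X = (\<Sum>i\<in>?K. ?a i *\<^sub>R ?p i)"
    using v fin rest(2) by simp
  moreover have "(\<Sum>i\<in>?K. ?a i *\<^sub>R ?p i) \<in> convex hull ({q} \<union> P ` (I - V))"
  proof (rule convex_sum[OF _ convex_convex_hull total])
    show "finite ?K" using fin by simp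
    show "0 \<le> ?a i" if "i \<in> ?K" for i
      using that x(1) \<open>V \<subseteq> I\<close> by (auto intro!: sum_nonneg)
    show "?p i \<in> convex hull ({q} \<union> P ` (I - V))" if "i \<in> ?K" for i
      using that by (auto intro!: hull_inc)
  qed
  ultimately show "X \<in> convex hull ({q} \<union> P ` (I - V))"
    by simp
qed

section \<open>Concurrent cevians\<close>

theorem theorem2p1:
  fixes n k l :: nat
    and P :: "nat \<Rightarrow> 'a::euclidean_space"
    and Q :: "nat set \<Rightarrow> 'a"
  assumes "n \<ge> 2" and "1 \<le> k" and "k < n" and "l = n + 1 - k"
    and "DIM('a) = n"
    and "inj_on P {0..n}" and "\<not> affine_dependent (P ` {0..n})"
    and "\<And>V. V \<subseteq> {0..n} \<Longrightarrow> card V = l \<Longrightarrow> Q V \<in> simplex_interior (P ` V)"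
  shows "(\<exists>X \<in> simplex_interior (P ` {0..n}). X \<in> \<Inter> (cevian_family n k P Q))
     \<longleftrightarrow> (\<forall>J. J \<subseteq> {0..n} \<and> card J = l + 1 \<longrightarrow> \<Inter> (induced_family n P Q J) \<noteq> {})"
proof -
  have l: "2 \<le> l" "l < card {0..n}"
    using assms(2-4) by auto
  have faces: "finite J" "inj_on P J" "\<not> affine_dependent (P ` J)" if "J \<subseteq> {0..n}" for J
    using that assms(6,7) affine_independent_subset[OF assms(7) image_mono]
    by (auto intro: finite_subset inj_on_subset)
  have "\<exists>w. (\<forall>i\<in>V. 0 < w i) \<and> sum w V = 1 \<and> Q V = (\<Sum>i\<in>V. w i *\<^sub>R P i)"
    if "V \<subseteq> {0..n}" "card V = l" for V
    using assms(8)[OF that] simplex_interior_image[OF faces(2)[OF that(1)]] by blast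
  then obtain w where w: "\<And>V i. V \<subseteq> {0..n} \<Longrightarrow> card V = l \<Longrightarrow> i \<in> V \<Longrightarrow> 0 < w V i"
      "\<And>V. V \<subseteq> {0..n} \<Longrightarrow> card V = l \<Longrightarrow> sum (w V) V = 1"
      "\<And>V. V \<subseteq> {0..n} \<Longrightarrow> card V = l \<Longrightarrow> Q V = (\<Sum>i\<in>V. w V i *\<^sub>R P i)"
    by metis
  have mem_cevian: "X \<in> cevian n P Q V \<longleftrightarrow> proportional_on V x (w V)"
    if "V \<subseteq> {0..n}" "card V = l" "\<And>i. i \<in> {0..n} \<Longrightarrow> 0 \<le> x i" "sum x {0..n} = 1"
      "X = (\<Sum>i\<in>{0..n}. x i *\<^sub>R P i)" for X V x
    unfolding cevian_def
    using mem_cevian_iff_proportional[OF faces[OF subset_refl] that(1) w(2,3)[OF that(1,2)] that(3-5)]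
    by blast
  have mem_induced: "X \<in> induced_cevian n P Q J t \<longleftrightarrow> proportional_on (J - {t}) x (w (J - {t}))"
    if "J \<subseteq> {0..n}" "card J = l + 1" "t \<in> J" "\<And>i. i \<in> J \<Longrightarrow> 0 \<le> x i" "sum x J = 1"
      "X = (\<Sum>i\<in>J. x i *\<^sub>R P i)" for X J t x
  proof -
    have V: "J - {t} \<subseteq> {0..n}" "card (J - {t}) = l"
      using that(1-3) faces(1) by auto
    have "induced_cevian n P Q J t = convex hull ({Q (J - {t})} \<union> P ` (J - (J - {t})))"
      using induced_cevian_eq[where Q = Q, OF assms(6,7) that(1,3) assms(8)[OF V]] that(1,3)
      by (simp add: Diff_Diff_Int insert_commute)
    then show ?thesis
      using mem_cevian_iff_proportional[OF faces[OF that(1)] Diff_subset w(2,3)[OF V] that(4-6)]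
      by blast
  qed
  show ?thesis
  proof (intro iffI allI impI)
    fix J
    assume "\<exists>X \<in> simplex_interior (P ` {0..n}). X \<in> \<Inter> (cevian_family n k P Q)"
      and J: "J \<subseteq> {0..n} \<and> card J = l + 1"
    then obtain X where "X \<in> simplex_interior (P ` {0..n})"
      and "X \<in> \<Inter> (cevian_family n k P Q)"
      by blast
    then have X: "X \<in> cevian n P Q V" if "V \<subseteq> {0..n}" "card V = l" for V
      using that assms(4) unfolding cevian_family_def by blast
    obtain x where x: "\<forall>i\<in>{0..n}. 0 < x i" "sum x {0..n} = 1" "X = (\<Sum>i\<in>{0..n}. x i *\<^sub>R P i)"
      using \<open>X \<in> simplex_interior (P ` {0..n})\<close> unfolding simplex_interior_image[OF assms(6)]
      by blast
    have "0 < sum x J"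
      using J x(1) faces(1) by (intro sum_pos) auto
    define y where "y = (\<lambda>i. x i / sum x J)"
    have y: "\<And>i. i \<in> J \<Longrightarrow> 0 \<le> y i" "sum y J = 1"
      using J x(1) \<open>0 < sum x J\<close>
      by (auto simp: y_def less_imp_le subset_iff simp flip: sum_divide_distrib)
    have "(\<Sum>i\<in>J. y i *\<^sub>R P i) \<in> induced_cevian n P Q J t" if t: "t \<in> J" for t
    proof -
      have V: "J - {t} \<subseteq> {0..n}" "card (J - {t}) = l"
        using J t faces(1) by auto
      then have "proportional_on (J - {t}) x (w (J - {t}))"
        using X mem_cevian[OF V _ x(2,3)] x(1) by (simp add: less_imp_le)
      then have "proportional_on (J - {t}) y (w (J - {t}))"
        unfolding y_def by (rule proportional_on_scale)
      then show ?thesis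
        using mem_induced[OF _ _ t y refl] J by blast
    qed
    then show "\<Inter> (induced_family n P Q J) \<noteq> {}"
      unfolding induced_family_def by blast
  next
    assume concurrent: "\<forall>J. J \<subseteq> {0..n} \<and> card J = l + 1 \<longrightarrow> \<Inter> (induced_family n P Q J) \<noteq> {}"
    have "\<exists>y. (\<forall>i\<in>J. 0 < y i) \<and> (\<forall>t\<in>J. proportional_on (J - {t}) y (w (J - {t})))"
      if J: "J \<subseteq> {0..n}" "card J = Suc l" for J
    proof -
      have "\<Inter> (induced_family n P Q J) \<noteq> {}"
        using concurrent J by simp
      then obtain Y where "Y \<in> \<Inter> (induced_family n P Q J)"
        by blast
      then have Y: "Y \<in> induced_cevian n P Q J t" if "t \<in> J" for t
        using that unfolding induced_family_def by blast
      have "J \<noteq> {}" using J by auto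
      then have "Y \<in> convex hull (P ` J)"
        using Y unfolding induced_cevian_def face_def by blast
      then obtain y where y: "\<And>i. i \<in> J \<Longrightarrow> 0 \<le> y i" "sum y J = 1" "Y = (\<Sum>i\<in>J. y i *\<^sub>R P i)"
        using convex_hull_image_coordinates[OF faces(1,2)[OF J(1)]] by metis
      have prop_w: "proportional_on (J - {t}) y (w (J - {t}))" if "t \<in> J" for t
        using mem_induced[OF J(1) _ that y] J(2) Y[OF that] by simp
      have "0 < w (J - {t}) i" if "t \<in> J" "i \<in> J - {t}" for t i
        using that J faces(1) by (intro w(1)) auto
      then have "0 < y i" if "i \<in> J" for i
        using pos_if_proportional_on_facets[OF faces(1)[OF J(1)] _ y(1,2) _ prop_w that] l(1) J(2)
        by simp
      then show ?thesis
        using prop_w by blast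
    qed
    then obtain x where x: "\<forall>i\<in>{0..n}. 0 < x i"
        "\<forall>V. V \<subseteq> {0..n} \<longrightarrow> card V = l \<longrightarrow> proportional_on V x (w V)"
      using common_coordinates_exist[of "{0..n}" l w] l w(1) by blast
    define z where "z = (\<lambda>i. x i / sum x {0..n})"
    have "0 < sum x {0..n}"
      using x(1) by (intro sum_pos) auto
    then have z: "\<forall>i\<in>{0..n}. 0 < z i" "sum z {0..n} = 1"
      using x(1) by (auto simp: z_def simp flip: sum_divide_distrib)
    let ?X = "\<Sum>i\<in>{0..n}. z i *\<^sub>R P i"
    have "?X \<in> cevian n P Q V" if V: "V \<subseteq> {0..n}" "card V = l" for V
    proof -
      have "proportional_on V z (w V)"
        using x(2) V unfolding z_def by (intro proportional_on_scale) blast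
      then show ?thesis
        using mem_cevian[OF V _ z(2) refl] z(1) by (simp add: less_imp_le)
    qed
    moreover have "?X \<in> simplex_interior (P ` {0..n})"
      using simplex_interior_image[OF assms(6)] z by blast
    ultimately show "\<exists>X \<in> simplex_interior (P ` {0..n}). X \<in> \<Inter> (cevian_family n k P Q)"
      unfolding cevian_family_def using assms(4) by blast
  qed
qed

end
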